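(* Let $\mathcal{S}$ be a combinatorial substitution system (as defined in the context) that has no spurs, i.e.\ for every layer $L$ with parent $P$ and every tile type $t$ of $P$, the adjacency map of the deflation of $t$ from $P$ to $L$ never pairs a symbol $\mathrm{Ext}(u,v)$ with another symbol $\mathrm{Ext}(u',v')$. Then the neighbour language $\mathcal{N}$ of $\mathcal{S}$ is a regular language (over the finite alphabet of pairs of address symbols).
   Context: A combinatorial substitution system consists of: (i) a finite set of tile types, each with a finite number of edges indexed $0,1,\dots$; (ii) a finite set of layers, each with a designated parent layer and a set of tile types appearing in it, one layer being designated the base layer (layer $0$); layer $n+1$ is the parent of layer $n$; (iii) for every layer $L$ with parent $P$ and every tile type $t$ of $P$, a deflation of $t$ into $L$, specifying: for each edge $u$ of $t$ a number $n_u\ge1$ of sub-edges, indexed $-n_u+1,-n_u+3,\dots,n_u-1$ (so that sub-edge $v$ of one supertile's edge meets sub-edge $-v$ of the neighbouring supertile's edge); a finite list of subtiles with distinct indices, each with a tile type of $L$; and an adjacency map, a fixed-point-free involution on the set of symbols $\mathrm{Int}(i,j)$ (edge $j$ of subtile $i$) and $\mathrm{Ext}(u,v)$ (sub-edge $v$ of edge $u$ of $t$). Pairs $\mathrm{Int}\leftrightarrow\mathrm{Int}$ mean two subtiles meet along those edges; $\mathrm{Int}(i,j)\leftrightarrow\mathrm{Ext}(u,v)$ means edge $j$ of subtile $i$ is sub-edge $v$ of edge $u$ of the supertile; $\mathrm{Ext}\leftrightarrow\mathrm{Ext}$ pairs are called spurs (zero-thickness parts of the deflated outline containing no subtile). The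 system is assumed to describe a geometric substitution tiling: tiles are polygons meeting edge to edge (with "edges" subdivided so that each edge of one tile meets exactly one whole edge of a neighbour), and the $n$-fold deflation of a tile is the finite patch of tiles obtained by deflating it $n$ times according to these data. A (finite) edge address is a string $(t_0,e),(i_1,t_1),(i_2,t_2),\dots,(i_n,t_n)$ where $t_k$ is a tile type of layer $k$, $e$ is an edge index of $t_0$, and for each $k\ge1$, $i_k$ is a subtile index of the deflation of $t_k$ (from layer $k$ to layer $k-1$) whose subtile has type $t_{k-1}$; it identifies edge $e$ of a particular tile of the $n$-fold deflation of a tile of type $t_n$. Two addresses of equal length are combined into a single string of symbol pairs ("zipped"). The neighbour language $\mathcal{N}$ is the set of zipped pairs $(A,A')$ of edge addresses of the same length $n$, ending in the same supertile type $t_n=t'_n$, such that in the $n$-fold deflation of a single tile of type $t_n$ the tiles identified by $A$ and $A'$ are adjacent, meeting along exactly the edges specified by the first symbols of $A$ and $A'$. *)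

theory Defs
  imports Main
begin

section \<open>Combinatorial substitution systems\<close>

text \<open>
  The symbols on which the adjacency map of a deflation acts: \<open>IntE i j\<close> is edge \<open>j\<close> of
  subtile \<open>i\<close>, and \<open>ExtE u v\<close> is sub-edge \<open>v\<close> of edge \<open>u\<close> of the tile being deflated.
\<close>

datatype 'i edge_sym = IntE 'i nat | ExtE nat int

record ('t, 'i) deflation =
  num_sub :: "nat \<Rightarrow> nat"
  subtile :: "'i \<Rightarrow> 't option"
  adjmap :: "'i edge_sym \<Rightarrow> 'i edge_sym"

text \<open>
  \<open>defl S L t\<close> is the deflation, into the layer \<open>L\<close>, of a tile type \<open>t\<close> of the parent of \<open>L\<close>.
\<close>

record ('t, 'l, 'i) subst_sys =
  tile_types :: "'t set"
  num_edges :: "'t \<Rightarrow> nat"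
  layers :: "'l set"
  base_layer :: 'l
  parent :: "'l \<Rightarrow> 'l"
  types_of :: "'l \<Rightarrow> 't set"
  defl :: "'l \<Rightarrow> 't \<Rightarrow> ('t, 'i) deflation"

definition layer :: "('t, 'l, 'i) subst_sys \<Rightarrow> nat \<Rightarrow> 'l" where
  "layer S n = (parent S ^^ n) (base_layer S)"

text \<open>The indices \<open>-n+1, -n+3, \<dots>, n-1\<close>.\<close>

definition subedge_indices :: "nat \<Rightarrow> int set" where
  "subedge_indices n = (\<lambda>k. 2 * int k - int n + 1) ` {..<n}"

definition edge_syms :: "('t, 'l, 'i) subst_sys \<Rightarrow> 'l \<Rightarrow> 't \<Rightarrow> 'i edge_sym set" where
  "edge_syms S L t =
     {IntE i j | i j s. subtile (defl S L t) i = Some s \<and> j < num_edges S s} \<union>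
     {ExtE u v | u v. u < num_edges S t \<and> v \<in> subedge_indices (num_sub (defl S L t) u)}"

definition deflation_ok :: "('t, 'l, 'i) subst_sys \<Rightarrow> 'l \<Rightarrow> 't \<Rightarrow> bool" where
  "deflation_ok S L t \<longleftrightarrow>
     (\<forall>u < num_edges S t. num_sub (defl S L t) u \<ge> 1) \<and>
     finite (dom (subtile (defl S L t))) \<and>
     ran (subtile (defl S L t)) \<subseteq> types_of S L \<and>
     (\<forall>x \<in> edge_syms S L t.
        adjmap (defl S L t) x \<in> edge_syms S L t \<and>
        adjmap (defl S L t) x \<noteq> x \<and>
        adjmap (defl S L t) (adjmap (defl S L t) x) = x)"

definition subst_system :: "('t, 'l, 'i) subst_sys \<Rightarrow> bool" where
  "subst_system S \<longleftrightarrow>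
     finite (tile_types S) \<and>
     finite (layers S) \<and>
     base_layer S \<in> layers S \<and>
     (\<forall>L \<in> layers S. parent S L \<in> layers S) \<and>
     (\<forall>L \<in> layers S. types_of S L \<subseteq> tile_types S) \<and>
     (\<forall>L \<in> layers S. \<forall>t \<in> types_of S (parent S L). deflation_ok S L t)"

definition no_spurs :: "('t, 'l, 'i) subst_sys \<Rightarrow> bool" where
  "no_spurs S \<longleftrightarrow>
     (\<forall>L \<in> layers S. \<forall>t \<in> types_of S (parent S L). \<forall>u v u' v'.
        ExtE u v \<in> edge_syms S L t \<longrightarrow> adjmap (defl S L t) (ExtE u v) \<noteq> ExtE u' v')"

section \<open>Iterated deflation\<close>

text \<open>
  A tile obtained by iterated deflation is named by its type together with the list of
  pairs (subtile index, supertile type), innermost supertile first.  A patch consists of tiles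
  and the relation of two tile edges meeting; the edges on its outline meet nothing.
\<close>

type_synonym ('t, 'i) tile = "'t \<times> ('i \<times> 't) list"
type_synonym ('t, 'i) tile_edge = "('t, 'i) tile \<times> nat"

record ('t, 'i) patch =
  tiles :: "('t, 'i) tile set"
  meets :: "(('t, 'i) tile_edge \<times> ('t, 'i) tile_edge) set"

definition single_tile :: "'t \<Rightarrow> ('t, 'i) patch" where
  "single_tile t = \<lparr>tiles = {(t, [])}, meets = {}\<rparr>"

text \<open>
  When all tiles of a patch \<open>P\<close> are deflated into the layer \<open>L\<close>, the partner of a subtile edge
  is found by applying the adjacency map of its supertile.  If this gives a sub-edge \<open>v\<close>
  of an edge of the supertile, and that edge meets an edge of another tile of \<open>P\<close>, one crosses over
  to sub-edge \<open>-v\<close> of the latter and applies the adjacency map there.  Spurs can make several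
  crossings necessary.
\<close>

inductive trace ::
  "('t, 'l, 'i) subst_sys \<Rightarrow> 'l \<Rightarrow> ('t, 'i) patch \<Rightarrow>
   ('t, 'i) tile \<times> 'i edge_sym \<Rightarrow> ('t, 'i) tile \<times> 'i edge_sym \<Rightarrow> bool"
  for S L P where
  start: "T \<in> tiles P \<Longrightarrow> IntE i j \<in> edge_syms S L (fst T) \<Longrightarrow>
    trace S L P (T, IntE i j) (T, adjmap (defl S L (fst T)) (IntE i j))"
| cross: "trace S L P x (T, ExtE u v) \<Longrightarrow> ((T, u), (T', u')) \<in> meets P \<Longrightarrow>
    trace S L P x (T', adjmap (defl S L (fst T')) (ExtE u' (- v)))"

definition deflate_patch ::
  "('t, 'l, 'i) subst_sys \<Rightarrow> 'l \<Rightarrow> ('t, 'i) patch \<Rightarrow> ('t, 'i) patch" where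
  "deflate_patch S L P =
     \<lparr>tiles = {(s, (i, t) # p) | s i t p.
                 (t, p) \<in> tiles P \<and> subtile (defl S L t) i = Some s},
      meets = {(((s, (i, t) # p), j), ((s', (i', t') # p'), j')) | s i t p j s' i' t' p' j'.
                 subtile (defl S L t) i = Some s \<and> subtile (defl S L t') i' = Some s' \<and>
                 trace S L P ((t, p), IntE i j) ((t', p'), IntE i' j')}\<rparr>"

text \<open>
  \<open>deflate_n S k d t\<close> is the \<open>d\<close>-fold deflation, down to layer \<open>k\<close>, of a tile of type \<open>t\<close> of
  layer \<open>k + d\<close>.
\<close>

primrec deflate_n :: "('t, 'l, 'i) subst_sys \<Rightarrow> nat \<Rightarrow> nat \<Rightarrow> 't \<Rightarrow> ('t, 'i) patch" where
  "deflate_n S k 0 t = single_tile t"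
| "deflate_n S k (Suc d) t = deflate_patch S (layer S k) (deflate_n S (Suc k) d t)"

text \<open>
  What a tiling described by the system has to satisfy for the sub-edges of two meeting edges to
  be matched as \<open>v\<close> against \<open>-v\<close>: edges that meet in an iterated deflation are
  subdivided into equally many sub-edges by the next deflation.
\<close>

definition edges_match :: "('t, 'l, 'i) subst_sys \<Rightarrow> bool" where
  "edges_match S \<longleftrightarrow>
     (\<forall>k d. \<forall>t \<in> types_of S (layer S (Suc k + d)). \<forall>T u T' u'.
        ((T, u), (T', u')) \<in> meets (deflate_n S (Suc k) d t) \<longrightarrow>
        num_sub (defl S (layer S k) (fst T)) u = num_sub (defl S (layer S k) (fst T')) u')"

section \<open>Addresses and the neighbour language\<close>

datatype ('t, 'i) addr_sym = EdgeSym 't nat | SubSym 'i 't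

text \<open>
  \<open>tile_name S k T\<close>: \<open>T\<close> is a well-formed name of a tile of layer \<open>k\<close> within some
  supertile.
\<close>

fun tile_name :: "('t, 'l, 'i) subst_sys \<Rightarrow> nat \<Rightarrow> ('t, 'i) tile \<Rightarrow> bool" where
  "tile_name S k (t, []) \<longleftrightarrow> t \<in> types_of S (layer S k)"
| "tile_name S k (t, (i, r) # p) \<longleftrightarrow>
     t \<in> types_of S (layer S k) \<and> subtile (defl S (layer S k) r) i = Some t \<and>
     tile_name S (Suc k) (r, p)"

fun top_type :: "('t, 'i) tile \<Rightarrow> 't" where
  "top_type (t, p) = last (t # map snd p)"

fun address :: "('t, 'i) tile_edge \<Rightarrow> ('t, 'i) addr_sym list" where
  "address ((t, p), e) = EdgeSym t e # map (\<lambda>(i, r). SubSym i r) p"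

definition edge_name :: "('t, 'l, 'i) subst_sys \<Rightarrow> nat \<Rightarrow> ('t, 'i) tile_edge \<Rightarrow> bool" where
  "edge_name S n x \<longleftrightarrow>
     tile_name S 0 (fst x) \<and> length (snd (fst x)) = n \<and> snd x < num_edges S (fst (fst x))"

definition neighbour_language ::
  "('t, 'l, 'i) subst_sys \<Rightarrow> (('t, 'i) addr_sym \<times> ('t, 'i) addr_sym) list set" where
  "neighbour_language S =
     {zip (address x) (address y) | x y n t.
        edge_name S n x \<and> edge_name S n y \<and>
        top_type (fst x) = t \<and> top_type (fst y) = t \<and>
        (x, y) \<in> meets (deflate_n S 0 n t)}"

definition addr_alphabet :: "('t, 'l, 'i) subst_sys \<Rightarrow> ('t, 'i) addr_sym set" where
  "addr_alphabet S =
     {EdgeSym t e | t e. t \<in> tile_types S \<and> e < num_edges S t} \<union>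
     {SubSym i t | i t. \<exists>L \<in> layers S.
        t \<in> types_of S (parent S L) \<and> i \<in> dom (subtile (defl S L t))}"

section \<open>Regular languages\<close>

text \<open>Recognisability by a deterministic finite automaton over a finite alphabet.\<close>

definition regular_over :: "'a set \<Rightarrow> 'a list set \<Rightarrow> bool" where
  "regular_over A W \<longleftrightarrow>
     finite A \<and>
     (\<exists>(Q :: nat set) q0 F \<delta>.
        finite Q \<and> q0 \<in> Q \<and> F \<subseteq> Q \<and> (\<forall>q \<in> Q. \<forall>a \<in> A. \<delta> q a \<in> Q) \<and>
        W = {w \<in> lists A. foldl \<delta> q0 w \<in> F})"

end

theory Submission
  imports Defs
begin

text \<open>
  Without spurs, whether two tile edges meet can be decided while reading their addresses from the
  innermost symbol outwards.  If the two edges are sub-edges \<open>v\<close> and \<open>-v\<close> of supertile edges,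
  they meet exactly if the supertile edges do, so the question moves up one level; if one of them is
  paired inside its supertile, then they meet exactly if they are paired with each other and the two
  supertiles are the same, that is, if the rest of the two addresses agrees.  A finite automaton
  therefore needs to remember only the current layer and either two edges of tile types or
  a single tile type.
\<close>

section \<open>Automata with an arbitrary finite set of states\<close>

text \<open>An injection of \<open>Q\<close> into the natural numbers renames the states, and
  \<open>inv_into\<close> decodes them before each transition. This allows the automaton below to
  have states in a datatype.\<close>

lemma regular_overI:
  fixes \<delta> :: "'q \<Rightarrow> 'a \<Rightarrow> 'q"
  assumes "finite A" and "finite Q" and "q0 \<in> Q" and "F \<subseteq> Q"
    and step: "\<And>q a. q \<in> Q \<Longrightarrow> a \<in> A \<Longrightarrow> \<delta> q a \<in> Q"
    and W: "W = {w \<in> lists A. foldl \<delta> q0 w \<in> F}"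
  shows "regular_over A W"
proof -
  obtain f :: "'q \<Rightarrow> nat" where f: "inj_on f Q"
    using finite_imp_inj_to_nat_seg[OF \<open>finite Q\<close>] by auto
  define \<delta>' where "\<delta>' m a = f (\<delta> (inv_into Q f m) a)" for m a
  have run: "foldl \<delta> q0 w \<in> Q \<and> foldl \<delta>' (f q0) w = f (foldl \<delta> q0 w)"
    if "w \<in> lists A" for w
    using that
  proof (induction w rule: rev_induct)
    case Nil
    show ?case using \<open>q0 \<in> Q\<close> by simp
  next
    case (snoc a w)
    then show ?case by (simp add: \<delta>'_def step inv_into_f_f[OF f])
  qed
  have "W = {w \<in> lists A. foldl \<delta>' (f q0) w \<in> f ` F}"
    unfolding W using run inj_on_image_mem_iff[OF f _ \<open>F \<subseteq> Q\<close>]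
    by (intro Collect_cong conj_cong refl) metis
  moreover have "\<forall>m \<in> f ` Q. \<forall>a \<in> A. \<delta>' m a \<in> f ` Q"
    by (auto simp: \<delta>'_def step inv_into_f_f[OF f])
  ultimately show ?thesis
    unfolding regular_over_def using assms(1-4)
    by (intro conjI exI[of _ "f ` Q"] exI[of _ "f q0"] exI[of _ "f ` F"] exI[of _ \<delta>']) auto
qed

section \<open>Edge symbols, layers and names of tiles\<close>

text \<open>Replacing \<open>k\<close> by \<open>n - 1 - k\<close> reverses the sub-edges and
  negates the index. It ensures that crossing an edge leads from a legitimate sub-edge to a
  legitimate one.\<close>

lemma uminus_subedge_indices:
  assumes "v \<in> subedge_indices n"
  shows "- v \<in> subedge_indices n"
proof -
  obtain k where "k < n" "v = 2 * int k - int n + 1"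
    using assms by (auto simp: subedge_indices_def)
  then have "- v = 2 * int (n - 1 - k) - int n + 1" "n - 1 - k < n" by auto
  then show ?thesis unfolding subedge_indices_def by blast
qed

lemma IntE_in_edge_syms:
  "IntE i j \<in> edge_syms S L t \<longleftrightarrow>
     (\<exists>s. subtile (defl S L t) i = Some s \<and> j < num_edges S s)"
  by (auto simp: edge_syms_def)

lemma ExtE_in_edge_syms:
  "ExtE u v \<in> edge_syms S L t \<longleftrightarrow>
     u < num_edges S t \<and> v \<in> subedge_indices (num_sub (defl S L t) u)"
  by (auto simp: edge_syms_def)

lemma layer_0 [simp]: "layer S 0 = base_layer S"
  by (simp add: layer_def)

lemma layer_Suc [simp]: "layer S (Suc n) = parent S (layer S n)"
  by (simp add: layer_def)

lemma tile_name_type: "tile_name S k (t, p) \<Longrightarrow> t \<in> types_of S (layer S k)"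
  by (cases p) auto

lemma tile_name_top_type:
  "tile_name S k (t, p) \<Longrightarrow> top_type (t, p) \<in> types_of S (layer S (k + length p))"
proof (induction p arbitrary: k t)
  case Nil
  then show ?case by simp
next
  case (Cons a p)
  obtain i r where a: "a = (i, r)" by (cases a)
  have "top_type (r, p) \<in> types_of S (layer S (Suc k + length p))"
    using Cons.IH[of "Suc k" r] Cons.prems by (simp add: a)
  then show ?case by (simp add: a)
qed

text \<open>From here on \<open>top_type\<close> is computed by recursion along the path, in step
  with \<open>tile_name\<close>, instead of by unfolding \<open>last\<close>.\<close>

lemma top_type_Cons [simp]: "top_type (t, (i, r) # p) = top_type (r, p)"
  by simp

declare top_type.simps [simp del]

lemma top_type_Nil [simp]: "top_type (t, []) = t"
  by (simp add: top_type.simps)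

text \<open>The finest deflation is applied last, so each step prepends one pair to the path and
  lowers the layer. The type of a new subtile lies in the right layer by
  \<open>deflation_ok\<close>.\<close>

lemma tiles_deflate_n:
  assumes "subst_system S" and "t \<in> types_of S (layer S (k + d))"
  shows "tiles (deflate_n S k d t) =
           {T. tile_name S k T \<and> length (snd T) = d \<and> top_type T = t}"
  using assms(2)
proof (induction d arbitrary: k)
  case 0
  then show ?case by (auto simp: single_tile_def)
next
  case (Suc d)
  have layer: "layer S k \<in> layers S" for k
    using assms(1) by (induction k) (auto simp: subst_system_def)
  have sub: "s \<in> types_of S (layer S k)"
    if "tile_name S (Suc k) (r, p)" "subtile (defl S (layer S k) r) i = Some s" for r p i s
  proof -
    have "ran (subtile (defl S (layer S k) r)) \<subseteq> types_of S (layer S k)"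
      using tile_name_type[OF that(1)] assms(1) layer[of k]
      by (auto simp: subst_system_def deflation_ok_def)
    then show ?thesis using that(2) by (auto intro: ranI)
  qed
  have IH: "tiles (deflate_n S (Suc k) d t) =
      {T. tile_name S (Suc k) T \<and> length (snd T) = d \<and> top_type T = t}"
    using Suc.IH[of "Suc k"] Suc.prems by simp
  show ?case
  proof (intro set_eqI)
    fix T :: "('a, 'c) tile"
    obtain s p where T: "T = (s, p)" by (cases T)
    show "T \<in> tiles (deflate_n S k (Suc d) t) \<longleftrightarrow>
        T \<in> {T. tile_name S k T \<and> length (snd T) = Suc d \<and> top_type T = t}"
      by (cases p) (auto simp: T deflate_patch_def IH intro: sub)
  qed
qed


section \<open>Meeting edges of a system without spurs\<close>

locale spurless_system =
  fixes S :: "('t, 'l, 'i) subst_sys"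
  assumes sys: "subst_system S" and match: "edges_match S" and spurless: "no_spurs S"
begin

lemma layer_in_layers: "layer S k \<in> layers S"
  using sys by (induction k) (auto simp: subst_system_def)

lemma types_of_subset: "L \<in> layers S \<Longrightarrow> types_of S L \<subseteq> tile_types S"
  using sys by (auto simp: subst_system_def)

lemma parent_in_layers: "L \<in> layers S \<Longrightarrow> parent S L \<in> layers S"
  using sys by (auto simp: subst_system_def)

context
  fixes L t
  assumes L: "L \<in> layers S" and t: "t \<in> types_of S (parent S L)"
begin

lemma adjmap_in_edge_syms:
  "x \<in> edge_syms S L t \<Longrightarrow> adjmap (defl S L t) x \<in> edge_syms S L t"
  using sys L t by (auto simp: subst_system_def deflation_ok_def)

lemma adjmap_adjmap:
  "x \<in> edge_syms S L t \<Longrightarrow> adjmap (defl S L t) (adjmap (defl S L t) x) = x"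
  using sys L t by (auto simp: subst_system_def deflation_ok_def)

text \<open>This is where the absence of spurs enters: a sub-edge of the outline leads straight to
  an edge of a subtile.\<close>

lemma adjmap_ExtE:
  assumes "ExtE u v \<in> edge_syms S L t"
  obtains i j where "adjmap (defl S L t) (ExtE u v) = IntE i j"
  using spurless L t assms by (cases "adjmap (defl S L t) (ExtE u v)") (auto simp: no_spurs_def)

lemma finite_dom_subtile: "finite (dom (subtile (defl S L t)))"
  using sys L t by (auto simp: subst_system_def deflation_ok_def)

end

text \<open>After one crossing the adjacency map yields an \<open>IntE\<close> symbol, so no second
  crossing can follow. The second case is phrased by applying the adjacency map to \<open>z\<close>,
  which makes both ends look alike. The hypothesis on \<open>meets P\<close> is kept abstract
  because for iterated deflations it is itself proved by induction with this lemma.\<close>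

lemma trace_cases:
  assumes "trace S L P (T, IntE i j) (T', z)"
    and L: "L \<in> layers S"
    and tiles: "\<And>T. T \<in> tiles P \<Longrightarrow> fst T \<in> types_of S (parent S L)"
    and meets: "\<And>T u T' u'. ((T, u), (T', u')) \<in> meets P \<Longrightarrow>
      T \<in> tiles P \<and> T' \<in> tiles P \<and> u < num_edges S (fst T) \<and> u' < num_edges S (fst T') \<and>
      num_sub (defl S L (fst T)) u = num_sub (defl S L (fst T')) u'"
  shows "T \<in> tiles P \<and> T' \<in> tiles P \<and> IntE i j \<in> edge_syms S L (fst T) \<and>
    z \<in> edge_syms S L (fst T') \<and>
    (T' = T \<and> z = adjmap (defl S L (fst T)) (IntE i j) \<or>
     (\<exists>u v u' i' j'. adjmap (defl S L (fst T)) (IntE i j) = ExtE u v \<and>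
        ((T, u), (T', u')) \<in> meets P \<and> z = IntE i' j' \<and>
        adjmap (defl S L (fst T')) z = ExtE u' (- v)))"
  using assms(1)
proof (induction "(T, IntE i j)" "(T', z)" arbitrary: T' z)
  case start
  then show ?case using adjmap_in_edge_syms[OF L tiles] by auto
next
  case (cross T1 u v T2 u')
  \<comment> \<open>The trace before the crossing ends in an \<open>ExtE\<close> symbol, so the
    induction hypothesis leaves only its first alternative.\<close>
  have T1: "T1 = T" and adj: "adjmap (defl S L (fst T)) (IntE i j) = ExtE u v"
    using cross.hyps(2) by auto
  \<comment> \<open>Edges that meet have equally many sub-edges, so \<open>v\<close>, and with it
    \<open>- v\<close>, is an index on the other side as well.\<close>
  have "ExtE u' (- v) \<in> edge_syms S L (fst T2)"
    using cross.hyps(2) meets[OF cross.hyps(3)] uminus_subedge_indices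
    by (auto simp: ExtE_in_edge_syms)
  moreover have T2: "fst T2 \<in> types_of S (parent S L)"
    using meets[OF cross.hyps(3)] tiles by blast
  ultimately show ?case
    using cross.hyps(2,3) T1 adj meets[OF cross.hyps(3)] adjmap_ExtE[OF L T2]
      adjmap_in_edge_syms[OF L T2] adjmap_adjmap[OF L T2] by metis
qed

section \<open>Recursion for meeting edges in iterated deflations\<close>

text \<open>Together with \<open>edges_match\<close>, the induction hypothesis for the coarser patch
  gives what \<open>trace_cases\<close> requires of \<open>meets\<close>.\<close>

lemma meets_deflate_n_valid:
  assumes "t \<in> types_of S (layer S (k + d))"
    and "((T, u), (T', u')) \<in> meets (deflate_n S k d t)"
  shows "T \<in> tiles (deflate_n S k d t) \<and> T' \<in> tiles (deflate_n S k d t) \<and>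
    u < num_edges S (fst T) \<and> u' < num_edges S (fst T')"
  using assms
proof (induction d arbitrary: k T u T' u')
  case 0
  then show ?case by (simp add: single_tile_def)
next
  case (Suc d)
  let ?P = "deflate_n S (Suc k) d t"
  have t: "t \<in> types_of S (layer S (Suc k + d))" using Suc.prems(1) by simp
  obtain s i r p j s' i' r' p' j' where
    eq: "T = (s, (i, r) # p)" "u = j" "T' = (s', (i', r') # p')" "u' = j'"
    and sub: "subtile (defl S (layer S k) r) i = Some s" "subtile (defl S (layer S k) r') i' = Some s'"
    and trace: "trace S (layer S k) ?P ((r, p), IntE i j) ((r', p'), IntE i' j')"
    using Suc.prems(2) by (auto simp: deflate_patch_def)
  have "(r, p) \<in> tiles ?P \<and> (r', p') \<in> tiles ?P \<and>
      IntE i j \<in> edge_syms S (layer S k) r \<and> IntE i' j' \<in> edge_syms S (layer S k) r'"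
  proof -
    have "fst T \<in> types_of S (parent S (layer S k))" if "T \<in> tiles ?P" for T
      using that tile_name_type[of S "Suc k" "fst T" "snd T"]
      by (simp add: tiles_deflate_n[OF sys t])
    moreover have "num_sub (defl S (layer S k) (fst T)) u = num_sub (defl S (layer S k) (fst T')) u'"
      if "((T, u), (T', u')) \<in> meets ?P" for T u T' u'
      using match t that unfolding edges_match_def by blast
    ultimately show ?thesis
      using trace_cases[OF trace layer_in_layers] Suc.IH[OF t] by simp
  qed
  then show ?case
    using sub by (auto simp: eq deflate_patch_def IntE_in_edge_syms)
qed

text \<open>A trace makes no crossing or exactly one, which gives the two disjuncts. Conversely,
  each disjunct builds a trace by \<open>start\<close>, followed in the second case by a single
  \<open>cross\<close>.\<close>

lemma meets_deflate_n_Suc_iff: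
  assumes names: "tile_name S k (s, (i, r) # p)" "tile_name S k (s', (i', r') # p')"
    and len: "length p = d" "length p' = d"
    and top: "top_type (r, p) = t" "top_type (r', p') = t"
    and edges: "j < num_edges S s" "j' < num_edges S s'"
  defines "adj \<equiv> \<lambda>r. adjmap (defl S (layer S k) r)"
  shows "(((s, (i, r) # p), j), ((s', (i', r') # p'), j')) \<in> meets (deflate_n S k (Suc d) t) \<longleftrightarrow>
    r = r' \<and> p = p' \<and> adj r (IntE i j) = IntE i' j' \<or>
    (\<exists>u v u'. adj r (IntE i j) = ExtE u v \<and> adj r' (IntE i' j') = ExtE u' (- v) \<and>
      (((r, p), u), ((r', p'), u')) \<in> meets (deflate_n S (Suc k) d t))"
    (is "?lhs \<longleftrightarrow> ?rhs")
proof -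
  let ?P = "deflate_n S (Suc k) d t"
  have t: "t \<in> types_of S (layer S (Suc k + d))"
    using tile_name_top_type[of S "Suc k" r p] names(1) len(1) top(1) by simp
  have sub: "subtile (defl S (layer S k) r) i = Some s" "subtile (defl S (layer S k) r') i' = Some s'"
    and T: "(r, p) \<in> tiles ?P" "(r', p') \<in> tiles ?P"
    using names len top by (auto simp: tiles_deflate_n[OF sys t])
  have syms: "IntE i j \<in> edge_syms S (layer S k) r" "IntE i' j' \<in> edge_syms S (layer S k) r'"
    using sub edges by (auto simp: IntE_in_edge_syms)
  have tiles: "fst T \<in> types_of S (parent S (layer S k))" if "T \<in> tiles ?P" for T
    using that tile_name_type[of S "Suc k" "fst T" "snd T"]
    by (simp add: tiles_deflate_n[OF sys t])
  have num: "num_sub (defl S (layer S k) (fst T)) u = num_sub (defl S (layer S k) (fst T')) u'"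
    if "((T, u), (T', u')) \<in> meets ?P" for T u T' u'
    using match t that unfolding edges_match_def by blast
  have lhs: "?lhs \<longleftrightarrow> trace S (layer S k) ?P ((r, p), IntE i j) ((r', p'), IntE i' j')"
    using sub by (auto simp: deflate_patch_def)
  show ?thesis
  proof
    have meets: "T \<in> tiles ?P \<and> T' \<in> tiles ?P \<and> u < num_edges S (fst T) \<and>
        u' < num_edges S (fst T') \<and>
        num_sub (defl S (layer S k) (fst T)) u = num_sub (defl S (layer S k) (fst T')) u'"
      if "((T, u), (T', u')) \<in> meets ?P" for T u T' u'
      using meets_deflate_n_valid[OF t that] num[OF that] by simp
    assume ?lhs
    then have trace: "trace S (layer S k) ?P ((r, p), IntE i j) ((r', p'), IntE i' j')"
      unfolding lhs .
    show ?rhs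
      using trace_cases[OF trace layer_in_layers, OF tiles meets, simplified]
      unfolding adj_def by metis
  next
    have start: "trace S (layer S k) ?P ((r, p), IntE i j) ((r, p), adj r (IntE i j))"
      using trace.start[OF T(1), where S = S and L = "layer S k"] syms(1) by (simp add: adj_def)
    \<comment> \<open>\<open>cross\<close> applies the adjacency map to the \<open>ExtE\<close>
      symbol, whereas the disjunct starts from \<open>IntE i' j'\<close>; the involution reconciles
      them.\<close>
    have inv: "adj r' (adj r' (IntE i' j')) = IntE i' j'"
      unfolding adj_def using adjmap_adjmap[OF layer_in_layers _ syms(2)] tiles[OF T(2)] by simp
    assume ?rhs
    then show ?lhs
    proof (elim disjE exE conjE)
      assume "r = r'" "p = p'" "adj r (IntE i j) = IntE i' j'"
      then show ?lhs unfolding lhs using start by simp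
    next
      fix u v u'
      assume r: "adj r (IntE i j) = ExtE u v" and r': "adj r' (IntE i' j') = ExtE u' (- v)"
        and meets: "(((r, p), u), ((r', p'), u')) \<in> meets ?P"
      have "trace S (layer S k) ?P ((r, p), IntE i j) ((r', p'), adj r' (ExtE u' (- v)))"
        using trace.cross[OF start[unfolded r] meets]
        by (simp add: adj_def)
      then show ?lhs unfolding lhs using inv by (simp add: r')
    qed
  qed
qed

end


section \<open>The automaton\<close>

text \<open>
  \<open>Pending L t u t' u'\<close>: the input is accepted if edge \<open>u\<close> of the current tile of type \<open>t\<close>
  meets edge \<open>u'\<close> of the current tile of type \<open>t'\<close>, both of layer \<open>L\<close>.  \<open>Same L t\<close>: the
  edges meet provided that the current tiles, of type \<open>t\<close>, coincide.
\<close>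

datatype ('t, 'l) state = Init | Dead | Pending 'l 't nat 't nat | Same 'l 't

text \<open>The input may be any word, so each transition also checks that the symbols continue
  well-formed names. The layer is not part of the input and is carried along in the state.\<close>

fun step :: "('t, 'l, 'i) subst_sys \<Rightarrow> ('t, 'l) state \<Rightarrow>
    ('t, 'i) addr_sym \<times> ('t, 'i) addr_sym \<Rightarrow> ('t, 'l) state" where
  "step S Init (EdgeSym t u, EdgeSym t' u') =
     (if t \<in> types_of S (base_layer S) \<and> t' \<in> types_of S (base_layer S) \<and>
         u < num_edges S t \<and> u' < num_edges S t'
      then Pending (base_layer S) t u t' u' else Dead)"
| "step S (Pending L t u t' u') (SubSym i r, SubSym i' r') =
     (if r \<in> types_of S (parent S L) \<and> r' \<in> types_of S (parent S L) \<and>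
         subtile (defl S L r) i = Some t \<and> subtile (defl S L r') i' = Some t'
      then
        (case adjmap (defl S L r) (IntE i u) of
           IntE a b \<Rightarrow> if r = r' \<and> a = i' \<and> b = u' then Same (parent S L) r else Dead
         | ExtE w v \<Rightarrow>
             (case adjmap (defl S L r') (IntE i' u') of
                IntE a b \<Rightarrow> Dead
              | ExtE w' v' \<Rightarrow> if v' = - v then Pending (parent S L) r w r' w' else Dead))
      else Dead)"
| "step S (Same L t) (SubSym i r, SubSym i' r') =
     (if i = i' \<and> r = r' \<and> r \<in> types_of S (parent S L) \<and> subtile (defl S L r) i = Some t
      then Same (parent S L) r else Dead)"
| "step S _ _ = Dead"

definition states :: "('t, 'l, 'i) subst_sys \<Rightarrow> ('t, 'l) state set" where
  "states S = {Init, Dead} \<union>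
     {Pending L t u t' u' | L t u t' u'. L \<in> layers S \<and> t \<in> tile_types S \<and> t' \<in> tile_types S \<and>
        u < num_edges S t \<and> u' < num_edges S t'} \<union>
     {Same L t | L t. L \<in> layers S \<and> t \<in> tile_types S}"

text \<open>At the end of the input both current tiles should be the one top supertile. In a
  \<open>Same\<close> state the edges then meet; a \<open>Pending\<close> state would ask for two
  outline edges of a single tile to meet, which never happens.\<close>

definition final_states :: "('t, 'l, 'i) subst_sys \<Rightarrow> ('t, 'l) state set" where
  "final_states S = {Same L t | L t. L \<in> layers S \<and> t \<in> tile_types S}"

abbreviation sub_syms :: "('i \<times> 't) list \<Rightarrow> ('t, 'i) addr_sym list" where
  "sub_syms p \<equiv> map (\<lambda>(i, r). SubSym i r) p"

lemma foldl_step_Dead [simp]: "foldl (step S) Dead w = Dead"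
  by (induction w) auto

context spurless_system
begin

section \<open>Finiteness and closure of the automaton\<close>

lemma finite_states: "finite (states S)"
proof -
  let ?E = "SIGMA t : tile_types S. {..<num_edges S t}"
  have "states S \<subseteq> {Init, Dead} \<union>
      (\<lambda>(L, (t, u), (t', u')). Pending L t u t' u') ` (layers S \<times> ?E \<times> ?E) \<union>
      (\<lambda>(L, t). Same L t) ` (layers S \<times> tile_types S)"
    unfolding states_def by force
  then show ?thesis
    using sys by (elim finite_subset) (auto simp: subst_system_def)
qed

lemma finite_addr_alphabet: "finite (addr_alphabet S)"
proof -
  have "addr_alphabet S =
      (\<Union>t \<in> tile_types S. EdgeSym t ` {..<num_edges S t}) \<union>
      (\<Union>L \<in> layers S. \<Union>t \<in> types_of S (parent S L). (\<lambda>i. SubSym i t) ` dom (subtile (defl S L t)))"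
    unfolding addr_alphabet_def by blast
  moreover have "finite (types_of S (parent S L))" if "L \<in> layers S" for L
    using types_of_subset[OF parent_in_layers[OF that]] sys
    by (auto simp: subst_system_def intro: finite_subset)
  ultimately show ?thesis
    using sys finite_dom_subtile by (simp add: subst_system_def)
qed

lemma step_in_states:
  assumes "q \<in> states S"
  shows "step S q a \<in> states S"
proof (cases "(S, q, a)" rule: step.cases)
  case (1 S' t u t' u')
  then show ?thesis
    using types_of_subset sys by (auto simp: states_def subst_system_def)
next
  case (2 S' L t u t' u' i r i' r')
  have L: "L \<in> layers S" and u: "u < num_edges S t" "u' < num_edges S t'"
    using assms 2 by (auto simp: states_def)
  \<comment> \<open>Edge indices stay bounded because the adjacency map preserves
    \<open>edge_syms\<close>.\<close>
  have edge: "w < num_edges S r"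
    if "r \<in> types_of S (parent S L)" "subtile (defl S L r) i = Some t" "u < num_edges S t"
      "adjmap (defl S L r) (IntE i u) = ExtE w v" for r i t u w v
    using adjmap_in_edge_syms[OF L that(1), of "IntE i u"] that(2-)
    by (auto simp: IntE_in_edge_syms ExtE_in_edge_syms)
  show ?thesis
    using 2 L u edge parent_in_layers[OF L] types_of_subset[OF parent_in_layers[OF L]]
    by (auto simp: states_def split: edge_sym.split)
next
  case (3 S' L t i r i' r')
  then show ?thesis
    using assms parent_in_layers types_of_subset[OF parent_in_layers]
    by (auto simp: states_def)
qed (auto simp: states_def)

section \<open>Words accepted from each kind of state\<close>

text \<open>From \<open>Same\<close> the automaton survives exactly as long as both components agree
  and extend a well-formed name.\<close>

lemma accept_Same_iff:
  assumes "t \<in> types_of S (layer S k)"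
  shows "foldl (step S) (Same (layer S k) t) w \<in> final_states S \<longleftrightarrow>
    (\<exists>p. w = zip (sub_syms p) (sub_syms p) \<and> tile_name S k (t, p))"
  using assms
proof (induction w arbitrary: k t)
  case Nil
  then show ?case
    using types_of_subset[OF layer_in_layers] layer_in_layers by (auto simp: final_states_def)
next
  case (Cons a w)
  show ?case
  proof (cases "\<exists>i r. a = (SubSym i r, SubSym i r) \<and> r \<in> types_of S (layer S (Suc k)) \<and>
      subtile (defl S (layer S k) r) i = Some t")
    case True
    then obtain i r where a: "a = (SubSym i r, SubSym i r)"
      and r: "r \<in> types_of S (layer S (Suc k))" "subtile (defl S (layer S k) r) i = Some t" by blast
    have "foldl (step S) (Same (layer S k) t) (a # w) \<in> final_states S \<longleftrightarrow>
        (\<exists>p. w = zip (sub_syms p) (sub_syms p) \<and> tile_name S (Suc k) (r, p))"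
      using Cons.IH[OF r(1)] r by (simp add: a)
    also have "\<dots> \<longleftrightarrow> (\<exists>p. a # w = zip (sub_syms p) (sub_syms p) \<and> tile_name S k (t, p))"
    proof
      assume "\<exists>p. w = zip (sub_syms p) (sub_syms p) \<and> tile_name S (Suc k) (r, p)"
      then obtain p where "w = zip (sub_syms p) (sub_syms p)" "tile_name S (Suc k) (r, p)" by blast
      then show "\<exists>p. a # w = zip (sub_syms p) (sub_syms p) \<and> tile_name S k (t, p)"
        using Cons.prems r by (intro exI[of _ "(i, r) # p"]) (simp add: a)
    next
      assume "\<exists>p. a # w = zip (sub_syms p) (sub_syms p) \<and> tile_name S k (t, p)"
      then obtain p where p: "a # w = zip (sub_syms p) (sub_syms p)" "tile_name S k (t, p)" by blast
      then show "\<exists>p. w = zip (sub_syms p) (sub_syms p) \<and> tile_name S (Suc k) (r, p)"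
        by (cases p) (auto simp: a)
    qed
    finally show ?thesis .
  next
    case False
    then have "step S (Same (layer S k) t) a = Dead"
      by (cases "(S, Same (layer S k) t, a)" rule: step.cases) auto
    moreover have "\<not> (\<exists>p. a # w = zip (sub_syms p) (sub_syms p) \<and> tile_name S k (t, p))"
    proof
      assume "\<exists>p. a # w = zip (sub_syms p) (sub_syms p) \<and> tile_name S k (t, p)"
      then obtain p where "a # w = zip (sub_syms p) (sub_syms p)" "tile_name S k (t, p)" by blast
      then show False
        using False tile_name_type[of S "Suc k"] by (cases p) auto
    qed
    ultimately show ?thesis by (simp add: final_states_def)
  qed
qed

text \<open>The condition of the neighbour language, started at any layer \<open>k\<close> so that
  induction can move outwards; the number of deflations and the supertile type are read off the
  path.\<close>

definition meeting_paths :: "nat \<Rightarrow> 't \<Rightarrow> nat \<Rightarrow> 't \<Rightarrow> nat \<Rightarrow> ('i \<times> 't) list \<Rightarrow> ('i \<times> 't) list \<Rightarrow> bool"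
  where "meeting_paths k t u t' u' p p' \<longleftrightarrow>
    length p = length p' \<and> tile_name S k (t, p) \<and> tile_name S k (t', p') \<and>
    top_type (t, p) = top_type (t', p') \<and>
    (((t, p), u), ((t', p'), u')) \<in> meets (deflate_n S k (length p) (top_type (t, p)))"

lemma not_meeting_paths_Nil: "\<not> meeting_paths k t u t' u' [] p'"
  by (simp add: meeting_paths_def single_tile_def)

text \<open>Recasts the recursion for \<open>meets\<close> in the shape of a transition out of
  \<open>Pending\<close>: the first disjunct leads to \<open>Same\<close>, the second to
  \<open>Pending\<close> one layer up.\<close>

lemma meeting_paths_Cons_iff:
  assumes "t \<in> types_of S (layer S k)" "t' \<in> types_of S (layer S k)"
    and "u < num_edges S t" "u' < num_edges S t'"
  defines "adj \<equiv> \<lambda>r. adjmap (defl S (layer S k) r)"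
  shows "meeting_paths k t u t' u' ((i, r) # p) ((i', r') # p') \<longleftrightarrow>
    subtile (defl S (layer S k) r) i = Some t \<and> subtile (defl S (layer S k) r') i' = Some t' \<and>
    (r = r' \<and> p = p' \<and> tile_name S (Suc k) (r, p) \<and> adj r (IntE i u) = IntE i' u' \<or>
     (\<exists>w v w'. adj r (IntE i u) = ExtE w v \<and> adj r' (IntE i' u') = ExtE w' (- v) \<and>
       meeting_paths (Suc k) r w r' w' p p'))"
proof (cases "length p = length p' \<and> tile_name S k (t, (i, r) # p) \<and>
    tile_name S k (t', (i', r') # p') \<and> top_type (r, p) = top_type (r', p')")
  case True
  then have names: "tile_name S k (t, (i, r) # p)" "tile_name S k (t', (i', r') # p')"
    and len: "length p' = length p" and top: "top_type (r', p') = top_type (r, p)" by simp_all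
  have "meeting_paths k t u t' u' ((i, r) # p) ((i', r') # p') \<longleftrightarrow>
      (((t, (i, r) # p), u), ((t', (i', r') # p'), u'))
        \<in> meets (deflate_n S k (Suc (length p)) (top_type (r, p)))"
    using names len top by (simp add: meeting_paths_def del: deflate_n.simps)
  also have "\<dots> \<longleftrightarrow> r = r' \<and> p = p' \<and> adj r (IntE i u) = IntE i' u' \<or>
      (\<exists>w v w'. adj r (IntE i u) = ExtE w v \<and> adj r' (IntE i' u') = ExtE w' (- v) \<and>
        (((r, p), w), ((r', p'), w')) \<in> meets (deflate_n S (Suc k) (length p) (top_type (r, p))))"
    unfolding adj_def by (rule meets_deflate_n_Suc_iff[OF names refl len refl top assms(3,4)])
  finally show ?thesis
    using names len top by (simp add: meeting_paths_def del: deflate_n.simps)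
next
  \<comment> \<open>Either disjunct on the right, with the subtile conditions and the typing of
    \<open>t\<close> and \<open>t'\<close>, would force the failed condition, so both sides are
    false.\<close>
  case False
  then show ?thesis using assms by (auto simp: meeting_paths_def)
qed

text \<open>Each letter strips one pair from both paths. A transition to \<open>Same\<close> is
  settled by \<open>accept_Same_iff\<close>, one to \<open>Pending\<close> by the induction
  hypothesis.\<close>

lemma accept_Pending_iff:
  assumes "t \<in> types_of S (layer S k)" "t' \<in> types_of S (layer S k)"
    and "u < num_edges S t" "u' < num_edges S t'"
  shows "foldl (step S) (Pending (layer S k) t u t' u') w \<in> final_states S \<longleftrightarrow>
    (\<exists>p p'. w = zip (sub_syms p) (sub_syms p') \<and> meeting_paths k t u t' u' p p')"
  using assms
proof (induction w arbitrary: k t u t' u')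
  case Nil
  \<comment> \<open>\<open>zip\<close> truncates, so the equal lengths in
    \<open>meeting_paths\<close> are needed to conclude that both paths are empty.\<close>
  have "p = []" if "[] = zip (sub_syms p) (sub_syms p')" "meeting_paths k t u t' u' p p'" for p p'
    using that by (cases p; cases p') (auto simp: meeting_paths_def)
  then show ?case
    using not_meeting_paths_Nil by (fastforce simp: final_states_def)
next
  case (Cons a w)
  let ?L = "layer S k"
  let ?adj = "\<lambda>r. adjmap (defl S ?L r)"
  have split: "(\<exists>p p'. a # w = zip (sub_syms p) (sub_syms p') \<and> meeting_paths k t u t' u' p p') \<longleftrightarrow>
      (\<exists>i r p i' r' p'. a = (SubSym i r, SubSym i' r') \<and> w = zip (sub_syms p) (sub_syms p') \<and>
        meeting_paths k t u t' u' ((i, r) # p) ((i', r') # p'))" (is "?l \<longleftrightarrow> ?r")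
  proof
    assume ?l
    then obtain p p' where "a # w = zip (sub_syms p) (sub_syms p')" "meeting_paths k t u t' u' p p'"
      by blast
    then show ?r by (cases p; cases p') (auto, blast)
  next
    assume ?r
    then obtain i r p i' r' p' where "a = (SubSym i r, SubSym i' r')"
      "w = zip (sub_syms p) (sub_syms p')" "meeting_paths k t u t' u' ((i, r) # p) ((i', r') # p')"
      by blast
    then show ?l by (intro exI[of _ "(i, r) # p"] exI[of _ "(i', r') # p'"]) simp
  qed
  show ?case
  proof (cases "\<exists>i r i' r'. a = (SubSym i r, SubSym i' r') \<and>
      r \<in> types_of S (layer S (Suc k)) \<and> r' \<in> types_of S (layer S (Suc k)) \<and>
      subtile (defl S ?L r) i = Some t \<and> subtile (defl S ?L r') i' = Some t'")
    case False
    then have "step S (Pending ?L t u t' u') a = Dead"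
      by (cases "(S, Pending ?L t u t' u', a)" rule: step.cases) auto
    moreover have "\<not> ?r"
      using False tile_name_type[of S "Suc k"] unfolding meeting_paths_def tile_name.simps by blast
    ultimately show ?thesis unfolding split by (simp add: final_states_def)
  next
    case True
    then obtain i r i' r' where a: "a = (SubSym i r, SubSym i' r')"
      and r: "r \<in> types_of S (layer S (Suc k))" "r' \<in> types_of S (layer S (Suc k))"
      and sub: "subtile (defl S ?L r) i = Some t" "subtile (defl S ?L r') i' = Some t'" by blast
    have edge: "w < num_edges S r"
      if "r \<in> types_of S (layer S (Suc k))" "subtile (defl S ?L r) i = Some t" "u < num_edges S t"
        "?adj r (IntE i u) = ExtE w v" for r i t u w v
      using adjmap_in_edge_syms[OF layer_in_layers, of r k "IntE i u"] that
      by (auto simp: IntE_in_edge_syms ExtE_in_edge_syms)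
    have rhs: "(\<exists>p p'. a # w = zip (sub_syms p) (sub_syms p') \<and> meeting_paths k t u t' u' p p') \<longleftrightarrow>
      (\<exists>p p'. w = zip (sub_syms p) (sub_syms p') \<and>
        (r = r' \<and> p = p' \<and> tile_name S (Suc k) (r, p) \<and> ?adj r (IntE i u) = IntE i' u' \<or>
         (\<exists>w v w'. ?adj r (IntE i u) = ExtE w v \<and> ?adj r' (IntE i' u') = ExtE w' (- v) \<and>
           meeting_paths (Suc k) r w r' w' p p')))"
      unfolding split using sub by (auto simp: a meeting_paths_Cons_iff[OF Cons.prems])
    show ?thesis
    proof (cases "?adj r (IntE i u)")
      case (IntE x y)
      show ?thesis
        unfolding rhs using accept_Same_iff[OF r(1), of w] r sub
        by (auto simp: a IntE final_states_def)
    next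
      case ext: (ExtE x v)
      show ?thesis
      proof (cases "?adj r' (IntE i' u')")
        case (IntE x y)
        then show ?thesis
          unfolding rhs using r sub by (auto simp: a ext final_states_def)
      next
        case (ExtE x' v')
        show ?thesis
          unfolding rhs
          using Cons.IH[OF r edge[OF r(1) sub(1) Cons.prems(3) ext]
              edge[OF r(2) sub(2) Cons.prems(4) ExtE]] r sub
          by (auto simp: a ext ExtE final_states_def)
      qed
    qed
  qed
qed

text \<open>The first letter fixes two edges of base-layer tiles; the rest is the acceptance
  criterion for \<open>Pending\<close> at layer 0.\<close>

lemma accept_Init_iff:
  "foldl (step S) Init w \<in> final_states S \<longleftrightarrow> w \<in> neighbour_language S"
proof -
  have lang: "w \<in> neighbour_language S \<longleftrightarrow>
    (\<exists>t u t' u' p p'. w = (EdgeSym t u, EdgeSym t' u') # zip (sub_syms p) (sub_syms p') \<and>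
      u < num_edges S t \<and> u' < num_edges S t' \<and> meeting_paths 0 t u t' u' p p')"
    unfolding neighbour_language_def edge_name_def meeting_paths_def
    by (fastforce simp del: tile_name.simps)
  show ?thesis
  proof (cases "\<exists>t u t' u' v. w = (EdgeSym t u, EdgeSym t' u') # v \<and>
      t \<in> types_of S (layer S 0) \<and> t' \<in> types_of S (layer S 0) \<and>
      u < num_edges S t \<and> u' < num_edges S t'")
    case True
    then obtain t u t' u' v where w: "w = (EdgeSym t u, EdgeSym t' u') # v"
      and t: "t \<in> types_of S (layer S 0)" "t' \<in> types_of S (layer S 0)"
        "u < num_edges S t" "u' < num_edges S t'" by blast
    show ?thesis
      unfolding lang using accept_Pending_iff[OF t, of v] t by (simp add: w)
  next
    case False
    have "foldl (step S) Init w \<notin> final_states S"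
    proof (cases w)
      case Nil
      then show ?thesis by (simp add: final_states_def)
    next
      case (Cons a v)
      then have "step S Init a = Dead"
        using False by (cases "(S, Init :: ('t, 'l) state, a)" rule: step.cases) auto
      then show ?thesis by (simp add: Cons final_states_def)
    qed
    moreover have "w \<notin> neighbour_language S"
      unfolding lang meeting_paths_def using False tile_name_type[of S 0] by blast
    ultimately show ?thesis by simp
  qed
qed

section \<open>The alphabet and regularity\<close>

lemma set_address:
  assumes "edge_name S n x"
  shows "set (address x) \<subseteq> addr_alphabet S"
proof -
  obtain t p e where x: "x = ((t, p), e)" by (metis surj_pair)
  \<comment> \<open>The layer is left general since the tail of a path is a name one layer
    higher.\<close>
  have "set (sub_syms p) \<subseteq> addr_alphabet S" if "tile_name S k (t, p)" for k
    using that
  proof (induction p arbitrary: k t)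
    case Nil
    then show ?case by simp
  next
    case (Cons a p)
    obtain i r where a: "a = (i, r)" by (cases a)
    have name: "tile_name S (Suc k) (r, p)" and "subtile (defl S (layer S k) r) i = Some t"
      using Cons.prems by (auto simp: a)
    then have "SubSym i r \<in> addr_alphabet S"
      using layer_in_layers tile_name_type[OF name] unfolding addr_alphabet_def by fastforce
    then show ?case using Cons.IH[OF name] by (simp add: a)
  qed
  moreover have "EdgeSym t e \<in> addr_alphabet S"
    using assms types_of_subset[OF layer_in_layers[of 0]]
    by (auto simp: x edge_name_def addr_alphabet_def dest!: tile_name_type)
  ultimately show ?thesis
    using assms by (auto simp: x edge_name_def)
qed

lemma neighbour_language_subset:
  "neighbour_language S \<subseteq> lists (addr_alphabet S \<times> addr_alphabet S)"
proof
  fix w assume "w \<in> neighbour_language S"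
  then obtain x y n where w: "w = zip (address x) (address y)"
    and xy: "edge_name S n x" "edge_name S n y"
    unfolding neighbour_language_def by blast
  have "set w \<subseteq> set (address x) \<times> set (address y)"
    unfolding w by (auto dest: set_zip_leftD set_zip_rightD)
  then show "w \<in> lists (addr_alphabet S \<times> addr_alphabet S)"
    using set_address[OF xy(1)] set_address[OF xy(2)] by blast
qed

end

theorem theorem1:
  fixes S :: "('t, 'l, 'i) subst_sys"
  assumes "subst_system S"
    and "edges_match S"
    and "no_spurs S"
  shows "regular_over (addr_alphabet S \<times> addr_alphabet S) (neighbour_language S)"
proof -
  interpret spurless_system S by unfold_locales fact+
  show ?thesis
  proof (rule regular_overI)
    show "neighbour_language S =
        {w \<in> lists (addr_alphabet S \<times> addr_alphabet S). foldl (step S) Init w \<in> final_states S}"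
      using neighbour_language_subset by (auto simp: accept_Init_iff)
    show "final_states S \<subseteq> states S" "Init \<in> states S"
      by (auto simp: final_states_def states_def)
  qed (simp_all add: finite_addr_alphabet finite_states step_in_states)
qed

end
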